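(* There is a family of homotopy equivalences $\Gamma_{(X,\mathscr{A}_* )}\colon|\operatorname{Sd}\operatorname{Nrv}(\mathscr{A})|\to X$, one for every object $(X,\mathscr{A}_* )$ of $\mathsf{ClConv}_*$, that is natural with respect to the morphisms of $\mathsf{ClConv}_*$: for every morphism $(f,\varphi)\colon(X,\mathscr{A}_* )\to(Y,\mathscr{C}_* )$ in $\mathsf{ClConv}_*$ one has $$f\circ\Gamma_{(X,\mathscr{A}_* )}=\Gamma_{(Y,\mathscr{C}_* )}\circ|\operatorname{Sd}\varphi_*|.$$
   Context: For a cover $\mathscr{U}=(U_i)_{i\in I}$ of a space $X$ and $J\subseteq I$ write $U_J=\bigcap_{i\in J}U_i$. The nerve $\operatorname{Nrv}(\mathscr{U})$ is the abstract simplicial complex whose simplices are the finite subsets $J\subseteq I$ with $U_J\neq\emptyset$ (simplices are understood to be non-empty). $\operatorname{Sd}K$ denotes the barycentric subdivision of a simplicial complex $K$: its vertices are the simplices of $K$, and its simplices are the finite non-empty chains $\tau_0\subset\dots\subset\tau_m$ of simplices of $K$. $|\cdot|$ denotes geometric realization. A pointed cover $\mathscr{U}_*=(\mathscr{U}=(U_i)_{i\in I},(u_\sigma)_{\sigma\in\operatorname{Nrv}(\mathscr{U})})$ of $X$ is a cover $\mathscr{U}$ of $X$ together with a point $u_\sigma\in U_\sigma$ for every $\sigma\in\operatorname{Nrv}(\mathscr{U})$. A morphism of covered spaces $(f,\varphi)\colon(X,(A_i)_{i\in I})\to(Y,(C_\ell)_{\ell\in L})$ is a continuous map $f\colon X\to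 Y$ together with a map $\varphi\colon I\to L$ such that $f(A_i)\subseteq C_{\varphi(i)}$ for all $i\in I$. It induces a simplicial map $\varphi_*\colon\operatorname{Nrv}(\mathscr{A})\to\operatorname{Nrv}(\mathscr{C})$, $J\mapsto\varphi(J)$, and hence a simplicial map $\operatorname{Sd}\varphi_*\colon\operatorname{Sd}\operatorname{Nrv}(\mathscr{A})\to\operatorname{Sd}\operatorname{Nrv}(\mathscr{C})$ sending the vertex $J$ to the vertex $\varphi(J)$. A morphism of pointed covered spaces $(f,\varphi)\colon(X,\mathscr{A}_* )\to(Y,\mathscr{C}_* )$, with $\mathscr{A}_*=(\mathscr{A},(a_\sigma))$ and $\mathscr{C}_*=(\mathscr{C},(c_\sigma))$, is a morphism of covered spaces with $f(a_\sigma)=c_{\varphi_*(\sigma)}$ for every $\sigma\in\operatorname{Nrv}(\mathscr{A})$. The category $\mathsf{ClConv}_*$ has as objects the pointed covered spaces $(X,\mathscr{A}_* )$ where $X\subseteq\mathbb{R}^d$ and $\mathscr{A}$ is a cover of $X$ by finitely many closed convex subsets of $\mathbb{R}^d$; its morphisms are the morphisms $(f,\varphi)$ of pointed covered spaces such that $f$ is affine linear on each cover element. *)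

theory Defs
  imports "HOL-Analysis.Analysis" "HOL-Analysis.Finite_Function_Topology"
begin

section \<open>Euclidean spaces of varying dimension\<close>

text \<open>
  The objects considered below live in \<open>\<real>\<^sup>d\<close> for varying \<open>d\<close>, so all the spaces \<open>\<real>\<^sup>d\<close> are
  realized inside one type: \<open>\<real>\<^sup>d\<close> is the linear subspace of \<^typ>\<open>nat \<Rightarrow>\<^sub>0 real\<close> of vectors supported
  in \<open>{..<d}\<close>. Its vector space structure is coordinatewise; that its topology is the
  Euclidean one is lemma \<open>homeomorphic_map_Rn\<close>.
\<close>

definition Rn :: "nat \<Rightarrow> (nat \<Rightarrow>\<^sub>0 real) set"
  where "Rn d = {x. Poly_Mapping.keys x \<subseteq> {..<d}}"

lemma Rn_iff: "x \<in> Rn d \<longleftrightarrow> (\<forall>i\<ge>d. Poly_Mapping.lookup x i = 0)"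
proof -
  have "x \<in> Rn d \<longleftrightarrow> (\<forall>i. Poly_Mapping.lookup x i \<noteq> 0 \<longrightarrow> i < d)"
    by (simp add: Rn_def subset_iff in_keys_iff)
  then show ?thesis
    by (meson not_le)
qed

lemma dist_Rn:
  assumes "x \<in> Rn d" "y \<in> Rn d"
  shows "dist x y = (\<Sum>i<d. dist (Poly_Mapping.lookup x i) (Poly_Mapping.lookup y i))"
  unfolding dist_poly_mapping_def
  by (rule sum.mono_neutral_left) (use assms in \<open>auto simp: Rn_def in_keys_iff\<close>)

lemma lookup_Abs_Rn:
  fixes f :: "nat \<Rightarrow> real"
  assumes "\<forall>i\<ge>d. f i = 0"
  shows "Poly_Mapping.lookup (Abs_poly_mapping f) = f"
proof -
  have "{i. f i \<noteq> 0} \<subseteq> {..<d}"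
  proof
    fix i assume "i \<in> {i. f i \<noteq> 0}"
    then have "\<not> d \<le> i" using assms by blast
    then show "i \<in> {..<d}" by simp
  qed
  then have "finite {i. f i \<noteq> 0}"
    by (rule finite_subset) simp
  then show ?thesis
    by simp
qed

lemma dist_lookup_le:
  fixes x y :: "'v \<Rightarrow>\<^sub>0 real"
  shows "dist (Poly_Mapping.lookup x v) (Poly_Mapping.lookup y v) \<le> dist x y"
proof (cases "v \<in> Poly_Mapping.keys x \<union> Poly_Mapping.keys y")
  case True
  show ?thesis
    unfolding dist_poly_mapping_def
    by (rule member_le_sum[OF True]) (simp_all del: Un_iff)
next
  case False
  then show ?thesis
    by (simp add: in_keys_iff)
qed

lemma continuous_on_lookup:
  "continuous_on S (\<lambda>x :: 'v \<Rightarrow>\<^sub>0 real. Poly_Mapping.lookup x v)"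
  unfolding continuous_on_iff
proof (intro ballI allI impI)
  fix x :: "'v \<Rightarrow>\<^sub>0 real" and e :: real
  assume "0 < e"
  then show "\<exists>d>0. \<forall>y\<in>S. dist y x < d \<longrightarrow> dist (Poly_Mapping.lookup y v) (Poly_Mapping.lookup x v) < e"
    by (intro exI[of _ e]) (auto intro: le_less_trans[OF dist_lookup_le])
qed

lemma homeomorphic_map_Rn:
  "homeomorphic_map (top_of_set (Rn d)) (Euclidean_space d) Poly_Mapping.lookup"
proof -
  have E: "Euclidean_space d = top_of_set {f. \<forall>i\<ge>d. f i = 0}"
    by (simp add: Euclidean_space_def euclidean_product_topology)
  have c1: "continuous_on (Rn d) (Poly_Mapping.lookup :: _ \<Rightarrow> nat \<Rightarrow> real)"
    by (intro continuous_on_coordinatewise_then_product continuous_on_lookup)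
  have c2: "continuous_on {f. \<forall>i\<ge>d. f i = 0} (Abs_poly_mapping :: (nat \<Rightarrow> real) \<Rightarrow> _)"
    unfolding continuous_on_def
  proof (intro ballI)
    fix f :: "nat \<Rightarrow> real" assume f: "f \<in> {f. \<forall>i\<ge>d. f i = 0}"
    have mem: "Abs_poly_mapping g \<in> Rn d" if "\<forall>i\<ge>d. g i = (0::real)" for g
      using that lookup_Abs_Rn[OF that] by (simp add: Rn_iff)
    have ci: "((\<lambda>g::nat \<Rightarrow> real. g i) \<longlongrightarrow> f i) (at f within {f. \<forall>i\<ge>d. f i = 0})" for i
      using continuous_on_subset[OF continuous_on_product_coordinates[of i] subset_UNIV] f
      unfolding continuous_on_def by blast
    have "((\<lambda>g. \<Sum>i<d. dist (g i) (f i)) \<longlongrightarrow> (\<Sum>i<d. dist (f i) (f i)))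
            (at f within {f. \<forall>i\<ge>d. f i = 0})"
      by (intro tendsto_sum tendsto_dist ci tendsto_const)
    then have "((\<lambda>g. \<Sum>i<d. dist (g i) (f i)) \<longlongrightarrow> 0) (at f within {f. \<forall>i\<ge>d. f i = 0})"
      by simp
    moreover have "\<forall>\<^sub>F g in at f within {f. \<forall>i\<ge>d. f i = 0}.
        (\<Sum>i<d. dist (g i) (f i)) = dist (Abs_poly_mapping g) (Abs_poly_mapping f)"
      unfolding eventually_at_filter
      by (rule always_eventually) (use f in \<open>simp add: dist_Rn[OF mem mem] lookup_Abs_Rn\<close>)
    ultimately have "((\<lambda>g. dist (Abs_poly_mapping g) (Abs_poly_mapping f)) \<longlongrightarrow> 0)
        (at f within {f. \<forall>i\<ge>d. f i = 0})"
      by (rule Lim_transform_eventually)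
    then show "(Abs_poly_mapping \<longlongrightarrow> Abs_poly_mapping f) (at f within {f. \<forall>i\<ge>d. f i = 0})"
      by (subst tendsto_dist_iff)
  qed
  have "homeomorphic_maps (top_of_set (Rn d)) (Euclidean_space d)
          Poly_Mapping.lookup Abs_poly_mapping"
    unfolding homeomorphic_maps_def E
    using c1 c2 by (auto simp: Rn_iff lookup_Abs_Rn lookup_inverse)
  then show ?thesis
    by (rule homeomorphic_maps_imp_map)
qed


section \<open>Simplicial complexes\<close>

text \<open>An abstract simplicial complex is given by its set of (finite, non-empty) simplices.\<close>

definition nerve :: "'i set \<Rightarrow> ('i \<Rightarrow> 'a set) \<Rightarrow> 'i set set"
  where "nerve I A = {J. J \<subseteq> I \<and> finite J \<and> J \<noteq> {} \<and> (\<Inter>i\<in>J. A i) \<noteq> {}}"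

definition Sd :: "'v set set \<Rightarrow> 'v set set set"
  where "Sd K = {C. subset.chain K C \<and> finite C \<and> C \<noteq> {}}"

text \<open>
  A simplicial map is given by its map \<open>\<psi>\<close> on vertices, and sends a simplex \<open>\<sigma>\<close> to \<open>\<psi> ` \<sigma>\<close>.
  Hence the vertex map of the subdivided map is as follows.
\<close>

definition Sd_map :: "('v \<Rightarrow> 'w) \<Rightarrow> 'v set \<Rightarrow> 'w set"
  where "Sd_map \<psi> \<sigma> = \<psi> ` \<sigma>"

text \<open>Points of \<open>|K|\<close> are given by their barycentric coordinates.\<close>

definition realization_points :: "'v set set \<Rightarrow> ('v \<Rightarrow>\<^sub>0 real) set"
  where "realization_points K = {x. (\<forall>v. 0 \<le> Poly_Mapping.lookup x v) \<and> Poly_Mapping.keys x \<in> K \<and>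
           (\<Sum>v\<in>Poly_Mapping.keys x. Poly_Mapping.lookup x v) = 1}"

definition closed_simplex :: "'v set set \<Rightarrow> 'v set \<Rightarrow> ('v \<Rightarrow>\<^sub>0 real) set"
  where "closed_simplex K \<sigma> = {x \<in> realization_points K. Poly_Mapping.keys x \<subseteq> \<sigma>}"

text \<open>
  The topology on \<open>|K|\<close> is the weak one: coherent with the closed simplices, each of which has
  its topology as a subset of a finite-dimensional vector space. For a finite complex this is
  just the subspace topology, see lemma \<open>realization_finite\<close>.
\<close>

definition realization :: "'v set set \<Rightarrow> ('v \<Rightarrow>\<^sub>0 real) topology"
  where "realization K = topology (\<lambda>U. U \<subseteq> realization_points K \<and>
           (\<forall>\<sigma>\<in>K. openin (top_of_set (closed_simplex K \<sigma>)) (U \<inter> closed_simplex K \<sigma>)))"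

lemma openin_realization:
  "openin (realization K) U \<longleftrightarrow> U \<subseteq> realization_points K \<and>
     (\<forall>\<sigma>\<in>K. openin (top_of_set (closed_simplex K \<sigma>)) (U \<inter> closed_simplex K \<sigma>))"
proof -
  have "istopology (\<lambda>U. U \<subseteq> realization_points K \<and>
     (\<forall>\<sigma>\<in>K. openin (top_of_set (closed_simplex K \<sigma>)) (U \<inter> closed_simplex K \<sigma>)))"
    unfolding istopology_def
  proof (intro conjI allI impI ballI, goal_cases)
    case (1 S T)
    then show ?case by blast
  next
    case (2 S T \<sigma>)
    have "S \<inter> T \<inter> C = (S \<inter> C) \<inter> (T \<inter> C)" for C by blast
    then show ?case using 2 by (simp add: openin_Int)
  next
    case (3 \<U>)
    then show ?case by blast
  next
    case (4 \<U> \<sigma>)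
    have "\<Union>\<U> \<inter> closed_simplex K \<sigma> = (\<Union>U\<in>\<U>. U \<inter> closed_simplex K \<sigma>)"
      by blast
    moreover have "openin (top_of_set (closed_simplex K \<sigma>)) (\<Union>U\<in>\<U>. U \<inter> closed_simplex K \<sigma>)"
      using 4 by (intro openin_Union) blast
    ultimately show ?case by simp
  qed
  then show ?thesis
    unfolding realization_def by (simp add: topology_inverse')
qed

lemma topspace_realization [simp]: "topspace (realization K) = realization_points K"
proof (rule subset_antisym)
  have "realization_points K \<inter> closed_simplex K \<sigma> = closed_simplex K \<sigma>" for \<sigma>
    by (auto simp: closed_simplex_def)
  then have "openin (realization K) (realization_points K)"
    by (simp add: openin_realization)
  then show "realization_points K \<subseteq> topspace (realization K)"
    by (rule openin_subset)
  show "topspace (realization K) \<subseteq> realization_points K"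
    using openin_topspace[of "realization K"] unfolding openin_realization by (rule conjunct1)
qed

lemma closed_Collect_keys_subset: "closed {x :: 'v \<Rightarrow>\<^sub>0 real. Poly_Mapping.keys x \<subseteq> \<sigma>}"
proof -
  have "{x :: 'v \<Rightarrow>\<^sub>0 real. Poly_Mapping.keys x \<subseteq> \<sigma>} = (\<Inter>v\<in>-\<sigma>. {x. Poly_Mapping.lookup x v = 0})"
    by (auto simp: in_keys_iff subset_iff)
  also have "closed \<dots>"
    by (intro closed_INT ballI closed_Collect_eq continuous_on_lookup continuous_on_const)
  finally show ?thesis .
qed

lemma realization_finite:
  assumes "finite K"
  shows "realization K = top_of_set (realization_points K)"
proof -
  let ?R = "realization_points K"
  have R: "?R = (\<Union>\<sigma>\<in>K. closed_simplex K \<sigma>)"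
    by (auto simp: closed_simplex_def realization_points_def)
  have sub: "closed_simplex K \<sigma> \<subseteq> ?R" for \<sigma>
    by (auto simp: closed_simplex_def)
  have cl: "closedin (top_of_set ?R) (closed_simplex K \<sigma>)" for \<sigma>
  proof -
    have "closed_simplex K \<sigma> = ?R \<inter> {x. Poly_Mapping.keys x \<subseteq> \<sigma>}"
      by (auto simp: closed_simplex_def)
    then show ?thesis
      using closed_Collect_keys_subset closedin_closed_Int by metis
  qed
  have "openin (realization K) U \<longleftrightarrow> openin (top_of_set ?R) U" for U
  proof
    assume "openin (top_of_set ?R) U"
    then obtain T where T: "open T" "U = ?R \<inter> T"
      by (auto simp: openin_open)
    have "U \<inter> closed_simplex K \<sigma> = closed_simplex K \<sigma> \<inter> T" for \<sigma>
      using T sub by blast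
    then show "openin (realization K) U"
      using T by (auto simp: openin_realization)
  next
    assume U: "openin (realization K) U"
    then have UR: "U \<subseteq> ?R"
      by (simp add: openin_realization)
    have "closedin (top_of_set ?R) (closed_simplex K \<sigma> - U)" if "\<sigma> \<in> K" for \<sigma>
    proof -
      have "openin (top_of_set (closed_simplex K \<sigma>)) (U \<inter> closed_simplex K \<sigma>)"
        using U that by (simp add: openin_realization)
      then have "closedin (top_of_set (closed_simplex K \<sigma>))
          (closed_simplex K \<sigma> - U \<inter> closed_simplex K \<sigma>)"
        by (simp add: closedin_def double_diff)
      then have "closedin (top_of_set (closed_simplex K \<sigma>)) (closed_simplex K \<sigma> - U)"
        by (simp add: Diff_Int)
      then show ?thesis
        using cl closedin_trans by blast
    qed
    then have "closedin (top_of_set ?R) (\<Union>\<sigma>\<in>K. closed_simplex K \<sigma> - U)"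
      using assms by (intro closedin_Union) auto
    moreover have "(\<Union>\<sigma>\<in>K. closed_simplex K \<sigma> - U) = ?R - U"
      using R by auto
    ultimately show "openin (top_of_set ?R) U"
      using UR by (simp add: openin_closedin_eq)
  qed
  then show ?thesis
    by (simp add: topology_eq)
qed

definition realization_map :: "('v \<Rightarrow> 'w) \<Rightarrow> ('v \<Rightarrow>\<^sub>0 real) \<Rightarrow> ('w \<Rightarrow>\<^sub>0 real)"
  where "realization_map \<psi> x =
           (\<Sum>v\<in>Poly_Mapping.keys x. Poly_Mapping.single (\<psi> v) (Poly_Mapping.lookup x v))"


section \<open>Homotopy equivalences\<close>

definition homotopy_equivalence :: "'a topology \<Rightarrow> 'b topology \<Rightarrow> ('a \<Rightarrow> 'b) \<Rightarrow> bool"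
  where "homotopy_equivalence X Y f \<longleftrightarrow> continuous_map X Y f \<and>
           (\<exists>g. continuous_map Y X g \<and>
                homotopic_with (\<lambda>_. True) X X (g \<circ> f) id \<and>
                homotopic_with (\<lambda>_. True) Y Y (f \<circ> g) id)"

lemma homotopy_equivalent_space_iff_homotopy_equivalence:
  "X homotopy_equivalent_space Y \<longleftrightarrow> (\<exists>f. homotopy_equivalence X Y f)"
  by (simp add: homotopy_equivalent_space_def homotopy_equivalence_def)


section \<open>The category of pointed spaces covered by closed convex sets\<close>

text \<open>
  Values of \<open>members\<close> outside of \<open>index\<close>, and of \<open>basepoint\<close> outside of the nerve, are irrelevant.
\<close>

record 'i pointed_covered_space =
  ambient_dim :: nat
  underlying :: "(nat \<Rightarrow>\<^sub>0 real) set"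
  index :: "'i set"
  members :: "'i \<Rightarrow> (nat \<Rightarrow>\<^sub>0 real) set"
  basepoint :: "'i set \<Rightarrow> (nat \<Rightarrow>\<^sub>0 real)"

abbreviation Nrv :: "'i pointed_covered_space \<Rightarrow> 'i set set"
  where "Nrv P \<equiv> nerve (index P) (members P)"

definition pointed_cover :: "'i pointed_covered_space \<Rightarrow> bool"
  where "pointed_cover P \<longleftrightarrow>
           (\<Union>i\<in>index P. members P i) = underlying P \<and>
           (\<forall>\<sigma>\<in>Nrv P. basepoint P \<sigma> \<in> (\<Inter>i\<in>\<sigma>. members P i))"

definition ClConv_obj :: "'i pointed_covered_space \<Rightarrow> bool"
  where "ClConv_obj P \<longleftrightarrow>
           pointed_cover P \<and>
           underlying P \<subseteq> Rn (ambient_dim P) \<and>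
           finite (index P) \<and>
           (\<forall>i\<in>index P. closedin (top_of_set (Rn (ambient_dim P))) (members P i) \<and>
                          convex (members P i))"

definition pointed_covered_mor ::
  "'i pointed_covered_space \<Rightarrow> 'j pointed_covered_space \<Rightarrow>
    ((nat \<Rightarrow>\<^sub>0 real) \<Rightarrow> (nat \<Rightarrow>\<^sub>0 real)) \<Rightarrow> ('i \<Rightarrow> 'j) \<Rightarrow> bool"
  where "pointed_covered_mor P Q f \<phi> \<longleftrightarrow>
           continuous_map (top_of_set (underlying P)) (top_of_set (underlying Q)) f \<and>
           \<phi> \<in> index P \<rightarrow> index Q \<and>
           (\<forall>i\<in>index P. f ` members P i \<subseteq> members Q (\<phi> i)) \<and>
           (\<forall>\<sigma>\<in>Nrv P. f (basepoint P \<sigma>) = basepoint Q (\<phi> ` \<sigma>))"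

text \<open>Only meant for convex \<open>S\<close>.\<close>

definition affine_linear_on :: "'a::real_vector set \<Rightarrow> ('a \<Rightarrow> 'b::real_vector) \<Rightarrow> bool"
  where "affine_linear_on S f \<longleftrightarrow>
           (\<forall>x\<in>S. \<forall>y\<in>S. \<forall>t\<in>{0..1}. f ((1 - t) *\<^sub>R x + t *\<^sub>R y) = (1 - t) *\<^sub>R f x + t *\<^sub>R f y)"

definition ClConv_mor ::
  "'i pointed_covered_space \<Rightarrow> 'j pointed_covered_space \<Rightarrow>
    ((nat \<Rightarrow>\<^sub>0 real) \<Rightarrow> (nat \<Rightarrow>\<^sub>0 real)) \<Rightarrow> ('i \<Rightarrow> 'j) \<Rightarrow> bool"
  where "ClConv_mor P Q f \<phi> \<longleftrightarrow>
           pointed_covered_mor P Q f \<phi> \<and> (\<forall>i\<in>index P. affine_linear_on (members P i) f)"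

end

theory Submission
  imports Defs
begin

text \<open>
  \<open>\<Gamma>\<close> maps the vertex \<open>\<sigma>\<close> to its base point and is extended affinely. On a chain with least
  element \<open>\<sigma>\<close> it takes values in every \<open>A i\<close> with \<open>i \<in> \<sigma>\<close>, which gives naturality.

  For a homotopy inverse, identify the points of \<open>|Sd K|\<close> with the functions \<open>h\<close> on the vertices
  of \<open>K\<close> with values in \<open>[0,1]\<close>, maximum \<open>1\<close> and support in \<open>K\<close>: the chain consists of the superlevel
  sets of \<open>h\<close>. The \<open>A i\<close> being closed, there are continuous functions \<open>w\<^sub>i\<close> that are \<open>1\<close> on \<open>A i\<close> and whose
  supports have the same nerve as the cover; they define \<open>g : X \<rightarrow> |Sd (nerve I A)|\<close>. If \<open>x \<in> A i\<close>, then
  \<open>w\<^sub>i\<close> attains its maximum at \<open>x\<close>, so that \<open>\<Gamma> (g x) \<in> A i\<close> and \<open>\<Gamma> \<circ> g\<close> is homotopic to the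
  identity along straight lines. Likewise the functions \<open>h\<close> of \<open>y\<close> and \<open>w (\<Gamma> y)\<close> of \<open>g (\<Gamma> y)\<close> are both \<open>1\<close>
  on the least element of the chain of \<open>y\<close>, so they can be joined by straight lines through
  \<open>min h (w (\<Gamma> y))\<close>.
\<close>

section \<open>Preliminaries on coordinates, finite extrema and affine maps\<close>

lemma lookup_scaleR [simp]:
  fixes x :: "'v \<Rightarrow>\<^sub>0 'a::real_vector"
  shows "Poly_Mapping.lookup (r *\<^sub>R x) v = r *\<^sub>R Poly_Mapping.lookup x v"
proof -
  have "finite {v. r *\<^sub>R Poly_Mapping.lookup x v \<noteq> 0}"
    by (rule finite_subset[of _ "Poly_Mapping.keys x"]) (auto simp: in_keys_iff)
  then show ?thesis
    by (simp add: scaleR_poly_mapping_def)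
qed

lemma continuous_on_Max_image:
  fixes f :: "'i \<Rightarrow> 'a::topological_space \<Rightarrow> real"
  assumes "finite S" "S \<noteq> {}" "\<And>i. i \<in> S \<Longrightarrow> continuous_on T (f i)"
  shows "continuous_on T (\<lambda>x. Max ((\<lambda>i. f i x) ` S))"
  using assms by (induction rule: finite_ne_induct) (auto intro!: continuous_on_max)

lemma continuous_on_Min_image:
  fixes f :: "'i \<Rightarrow> 'a::topological_space \<Rightarrow> real"
  assumes "finite S" "S \<noteq> {}" "\<And>i. i \<in> S \<Longrightarrow> continuous_on T (f i)"
  shows "continuous_on T (\<lambda>x. Min ((\<lambda>i. f i x) ` S))"
  using assms by (induction rule: finite_ne_induct) (auto intro!: continuous_on_min)

text \<open>\<open>affine_linear_on\<close> speaks of segments only, so points are split off one at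
  a time: the other weights are rescaled by \<open>1 - a k\<close>, and convexity keeps the rescaled
  combination inside \<open>C\<close>.\<close>

lemma affine_linear_on_sum:
  assumes f: "affine_linear_on C f" and "convex C" and "finite S"
    and "(\<Sum>i\<in>S. a i) = 1" "\<And>i. i \<in> S \<Longrightarrow> 0 \<le> a i" "\<And>i. i \<in> S \<Longrightarrow> y i \<in> C"
  shows "f (\<Sum>i\<in>S. a i *\<^sub>R y i) = (\<Sum>i\<in>S. a i *\<^sub>R f (y i))"
  using assms(3-)
proof (induction arbitrary: a rule: finite_induct)
  case empty
  then show ?case by simp
next
  case (insert k S)
  show ?case
  proof (cases "a k = 1")
    \<comment> \<open>Rescaling would divide by zero here, but all other weights vanish.\<close>
    case True
    then have "(\<Sum>i\<in>S. a i) = 0"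
      using insert by simp
    then have "\<forall>i\<in>S. a i = 0"
      using insert by (subst (asm) sum_nonneg_eq_0_iff) auto
    then show ?thesis
      using insert True by simp
  next
    case False
    define b where "b i = a i / (1 - a k)" for i
    have S: "(\<Sum>i\<in>S. a i) = 1 - a k"
      using insert by simp
    then have "0 \<le> 1 - a k"
      using insert by (metis insertCI sum_nonneg)
    then have ak: "a k < 1" "0 \<le> a k"
      using False insert by auto
    have b: "(\<Sum>i\<in>S. b i) = 1" "\<And>i. i \<in> S \<Longrightarrow> 0 \<le> b i"
      using S ak insert by (auto simp: b_def simp flip: sum_divide_distrib)
    have ab: "a i = (1 - a k) * b i" for i
      using ak by (simp add: b_def)
    have mem: "(\<Sum>i\<in>S. b i *\<^sub>R y i) \<in> C"
      using insert b by (intro convex_sum[OF _ \<open>convex C\<close>]) auto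
    have split: "(\<Sum>i\<in>S. a i *\<^sub>R z i) = (1 - a k) *\<^sub>R (\<Sum>i\<in>S. b i *\<^sub>R z i)" for z :: "_ \<Rightarrow> 'z::real_vector"
      unfolding scaleR_sum_right scaleR_scaleR ab[symmetric] ..
    have "f (\<Sum>i\<in>insert k S. a i *\<^sub>R y i) = f ((1 - a k) *\<^sub>R (\<Sum>i\<in>S. b i *\<^sub>R y i) + a k *\<^sub>R y k)"
      using insert by (simp add: split add.commute)
    also have "\<dots> = (1 - a k) *\<^sub>R f (\<Sum>i\<in>S. b i *\<^sub>R y i) + a k *\<^sub>R f (y k)"
      using f mem ak insert unfolding affine_linear_on_def by auto
    also have "f (\<Sum>i\<in>S. b i *\<^sub>R y i) = (\<Sum>i\<in>S. b i *\<^sub>R f (y i))"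
      using insert b by auto
    finally show ?thesis
      using insert by (simp add: split add.commute)
  qed
qed

section \<open>Points of the subdivision as functions on the vertices\<close>

text \<open>Inserting \<open>0\<close> gives \<open>Max\<close> a meaning for
  \<open>\<sigma> = I\<close> and counts positive levels only; the outer \<open>max 0\<close> gives
  weight zero to sets that are not superlevel sets.\<close>

definition level_weight :: "'i set \<Rightarrow> ('i \<Rightarrow> real) \<Rightarrow> 'i set \<Rightarrow> real"
  where "level_weight I h \<sigma> = max 0 (Min (h ` \<sigma>) - Max (insert 0 (h ` (I - \<sigma>))))"

text \<open>Summing over all non-empty subsets, instead of sorting the values of \<open>h\<close>,
  makes continuity in \<open>h\<close> a matter of the single terms.\<close>

definition decode :: "'i set \<Rightarrow> ('i \<Rightarrow> real) \<Rightarrow> ('i set \<Rightarrow>\<^sub>0 real)"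
  where "decode I h = (\<Sum>\<sigma>\<in>Pow I - {{}}. level_weight I h \<sigma> *\<^sub>R Poly_Mapping.single \<sigma> 1)"

text \<open>Layer-cake formula: the levels belonging to the simplices around \<open>i\<close> are
  stacked up to the height at \<open>i\<close>. As a sum over a fixed set it is continuous in
  \<open>y\<close>.\<close>

definition encode :: "'i set \<Rightarrow> ('i set \<Rightarrow>\<^sub>0 real) \<Rightarrow> 'i \<Rightarrow> real"
  where "encode I y i = (\<Sum>\<sigma> | \<sigma> \<subseteq> I \<and> i \<in> \<sigma>. Poly_Mapping.lookup y \<sigma>)"

lemma lookup_decode:
  assumes "finite I"
  shows "Poly_Mapping.lookup (decode I h) \<sigma> = (if \<sigma> \<subseteq> I \<and> \<sigma> \<noteq> {} then level_weight I h \<sigma> else 0)"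
proof -
  have "Poly_Mapping.lookup (decode I h) \<sigma> =
      (\<Sum>\<tau>\<in>Pow I - {{}}. if \<tau> = \<sigma> then level_weight I h \<tau> else 0)"
    unfolding decode_def lookup_sum by (rule sum.cong) (auto simp: lookup_single when_def)
  then show ?thesis
    using assms by (simp add: sum.delta)
qed

lemma continuous_on_decode:
  assumes I: "finite I" and p: "\<And>i. i \<in> I \<Longrightarrow> continuous_on T (\<lambda>x. p x i)"
  shows "continuous_on T (\<lambda>x. decode I (p x))"
proof -
  have "continuous_on T (\<lambda>x. level_weight I (p x) \<sigma>)" if "\<sigma> \<in> Pow I - {{}}" for \<sigma>
  proof -
    have "finite \<sigma>"
      using that I finite_subset by blast
    then have 1: "continuous_on T (\<lambda>x. Min (p x ` \<sigma>))"
      using that p by (intro continuous_on_Min_image) auto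
    have 2: "continuous_on T (\<lambda>x. Max (insert 0 (p x ` (I - \<sigma>))))"
    proof (cases "I - \<sigma> = {}")
      case True
      show ?thesis
        unfolding True by simp
    next
      case False
      then have "Max (insert 0 (p x ` (I - \<sigma>))) = max 0 (Max (p x ` (I - \<sigma>)))" for x
        using I by (intro Max_insert) auto
      moreover have "continuous_on T (\<lambda>x. Max (p x ` (I - \<sigma>)))"
        using False p I by (intro continuous_on_Max_image) auto
      ultimately show ?thesis
        by (simp add: continuous_on_max)
    qed
    show ?thesis
      unfolding level_weight_def by (intro continuous_on_max continuous_on_diff 1 2 continuous_on_const)
  qed
  then show ?thesis
    unfolding decode_def by (intro continuous_on_sum continuous_on_scaleR continuous_on_const)
qed

lemma level_weight_pos_iff:
  assumes "finite I" "\<sigma> \<subseteq> I" "\<sigma> \<noteq> {}"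
  shows "0 < level_weight I h \<sigma> \<longleftrightarrow> (\<forall>i\<in>\<sigma>. 0 < h i \<and> (\<forall>j\<in>I - \<sigma>. h j < h i))"
proof -
  have "finite \<sigma>" using assms finite_subset by blast
  then have "0 < level_weight I h \<sigma> \<longleftrightarrow> (\<forall>i\<in>\<sigma>. \<forall>r\<in>insert 0 (h ` (I - \<sigma>)). r < h i)"
    using assms unfolding level_weight_def by (subst less_max_iff_disj) auto
  then show ?thesis by auto
qed

text \<open>Serves \<open>decode_encode\<close>, where lower bounds suffice because the total weight
  is known.\<close>

lemma level_weight_ge:
  assumes "finite I" "\<sigma> \<subseteq> I" "\<sigma> \<noteq> {}"
    and "\<And>i. i \<in> \<sigma> \<Longrightarrow> c \<le> h i" "\<And>i j. i \<in> \<sigma> \<Longrightarrow> j \<in> I - \<sigma> \<Longrightarrow> c + h j \<le> h i"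
  shows "c \<le> level_weight I h \<sigma>"
proof -
  have "finite \<sigma>" using assms finite_subset by blast
  then have "Min (h ` \<sigma>) \<in> h ` \<sigma>"
    using assms by (intro Min_in) auto
  then obtain i where i: "i \<in> \<sigma>" "Min (h ` \<sigma>) = h i" by auto
  have "Max (insert 0 (h ` (I - \<sigma>))) \<in> insert 0 (h ` (I - \<sigma>))"
    using assms by (intro Max_in) auto
  then have "c + Max (insert 0 (h ` (I - \<sigma>))) \<le> h i"
    using assms i by auto
  then show ?thesis
    using i by (simp add: level_weight_def)
qed

text \<open>The weight of \<open>\<sigma>\<close> is the length of the interval of those \<open>t\<close> for which \<open>\<sigma>\<close> is the
  superlevel set of \<open>h\<close> at \<open>t\<close>; these intervals partition \<open>{0<..1}\<close>.\<close>

lemma sum_level_weight: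
  assumes I: "finite I" and h: "\<And>i. i \<in> I \<Longrightarrow> h i \<le> 1" and one: "\<exists>i\<in>I. h i = 1"
  shows "(\<Sum>\<sigma>\<in>Pow I - {{}}. level_weight I h \<sigma>) = 1"
proof -
  \<comment> \<open>Additivity of Lebesgue measure over the sets \<open>L \<sigma>\<close> replaces
    an induction along the sorted values of \<open>h\<close>.\<close>
  define L where "L \<sigma> = {t::real. t \<in> {0<..1} \<and> {i \<in> I. t \<le> h i} = \<sigma>}" for \<sigma>
  have L: "L \<sigma> = {Max (insert 0 (h ` (I - \<sigma>)))<..Min (h ` \<sigma>)}" if "\<sigma> \<in> Pow I - {{}}" for \<sigma>
  proof -
    have fin: "finite \<sigma>" and ne: "\<sigma> \<noteq> {}"
      using that I finite_subset by auto
    have "t \<in> L \<sigma> \<longleftrightarrow> 0 < t \<and> (\<forall>j\<in>I - \<sigma>. h j < t) \<and> (\<forall>i\<in>\<sigma>. t \<le> h i)" for t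
    proof -
      have "t \<le> 1" if "\<forall>i\<in>\<sigma>. t \<le> h i"
        using that ne h \<open>\<sigma> \<in> Pow I - {{}}\<close> by force
      then show ?thesis
        using that unfolding L_def by force
    qed
    moreover have "t \<le> Min (h ` \<sigma>) \<longleftrightarrow> (\<forall>i\<in>\<sigma>. t \<le> h i)" for t
      using fin ne by simp
    moreover have "Max (insert 0 (h ` (I - \<sigma>))) < t \<longleftrightarrow> 0 < t \<and> (\<forall>j\<in>I - \<sigma>. h j < t)" for t
      using I by simp
    ultimately show ?thesis
      by (intro set_eqI) (simp only: greaterThanAtMost_iff conj_assoc)
  qed
  have "(\<Sum>\<sigma>\<in>Pow I - {{}}. level_weight I h \<sigma>) = (\<Sum>\<sigma>\<in>Pow I - {{}}. measure lborel (L \<sigma>))"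
    by (rule sum.cong) (auto simp: L level_weight_def max_def)
  also have "\<dots> = measure lborel (\<Union>\<sigma>\<in>Pow I - {{}}. L \<sigma>)"
  proof (rule measure_finite_Union[symmetric])
    show "L ` (Pow I - {{}}) \<subseteq> sets lborel"
      by (auto simp: L)
    show "disjoint_family_on L (Pow I - {{}})"
      by (auto simp: disjoint_family_on_def L_def)
    show "emeasure lborel (L \<sigma>) \<noteq> \<infinity>" if "\<sigma> \<in> Pow I - {{}}" for \<sigma>
    proof -
      have "emeasure lborel {a<..b} \<noteq> \<infinity>" for a b :: real
        by (cases "a \<le> b") auto
      then show ?thesis
        unfolding L[OF that] .
    qed
  qed (use I in auto)
  \<comment> \<open>Since some \<open>h i\<close> is \<open>1\<close>, no level in
    \<open>{0<..1}\<close> has an empty superlevel set.\<close>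
  also have "(\<Union>\<sigma>\<in>Pow I - {{}}. L \<sigma>) = {0<..1}"
    using one by (force simp: L_def)
  finally show ?thesis by simp
qed

section \<open>Nerves, and the passage between \<open>|Sd K|\<close> and functions on the
  vertices\<close>

lemma nerve_mono:
  assumes \<sigma>: "\<sigma> \<in> nerve I A" and \<tau>: "\<tau> \<subseteq> \<sigma>" "\<tau> \<noteq> {}"
  shows "\<tau> \<in> nerve I A"
proof -
  have "(\<Inter>i\<in>\<sigma>. A i) \<subseteq> (\<Inter>i\<in>\<tau>. A i)"
    using \<tau> by blast
  moreover have "finite \<tau>"
    using \<sigma> \<tau> finite_subset by (auto simp: nerve_def)
  ultimately show ?thesis
    using \<sigma> \<tau> unfolding nerve_def by blast
qed

lemma finite_nerve: "finite I \<Longrightarrow> finite (nerve I A)"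
  by (rule finite_subset[of _ "Pow I"]) (auto simp: nerve_def)

lemma realization_Sd_nerve:
  assumes "finite I"
  shows "realization (Sd (nerve I A)) = top_of_set (realization_points (Sd (nerve I A)))"
proof (rule realization_finite, rule finite_subset)
  show "Sd (nerve I A) \<subseteq> Pow (nerve I A)"
    by (auto simp: Sd_def subset_chain_def)
qed (simp add: assms finite_nerve)

lemma keys_decodeD:
  assumes I: "finite I" and \<sigma>: "\<sigma> \<in> Poly_Mapping.keys (decode I h)"
  shows "\<sigma> \<subseteq> I \<and> \<sigma> \<noteq> {} \<and> (\<forall>i\<in>\<sigma>. 0 < h i \<and> (\<forall>j\<in>I - \<sigma>. h j < h i))"
proof -
  have "\<sigma> \<subseteq> I" "\<sigma> \<noteq> {}" "level_weight I h \<sigma> \<noteq> 0"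
    using \<sigma> by (auto simp: in_keys_iff lookup_decode[OF I] split: if_splits)
  moreover then have "0 < level_weight I h \<sigma>"
    by (simp add: level_weight_def max_def split: if_splits)
  ultimately show ?thesis
    using level_weight_pos_iff[OF I] by blast
qed

text \<open>Superlevel sets are nested, so those of positive weight form a chain; each lies in the
  support of \<open>h\<close> and hence is a simplex. The maximal value \<open>1\<close> normalizes
  the total weight.\<close>

lemma decode_mem_realization:
  assumes I: "finite I" and h: "\<And>i. i \<in> I \<Longrightarrow> h i \<le> 1" and one: "\<exists>i\<in>I. h i = 1"
    and supp: "{i \<in> I. 0 < h i} \<in> nerve I A"
  shows "decode I h \<in> realization_points (Sd (nerve I A))"
proof -
  let ?y = "decode I h"
  note keys = keys_decodeD[OF I, of _ h]
  have nn: "0 \<le> Poly_Mapping.lookup ?y \<sigma>" for \<sigma>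
    by (simp add: lookup_decode[OF I] level_weight_def)
  have "(\<Sum>\<sigma>\<in>Poly_Mapping.keys ?y. Poly_Mapping.lookup ?y \<sigma>) =
      (\<Sum>\<sigma>\<in>Pow I - {{}}. Poly_Mapping.lookup ?y \<sigma>)"
    by (rule sum.mono_neutral_left) (use I keys in \<open>auto simp: in_keys_iff\<close>)
  also have "\<dots> = (\<Sum>\<sigma>\<in>Pow I - {{}}. level_weight I h \<sigma>)"
    by (rule sum.cong) (auto simp: lookup_decode[OF I])
  finally have sum: "(\<Sum>\<sigma>\<in>Poly_Mapping.keys ?y. Poly_Mapping.lookup ?y \<sigma>) = 1"
    using sum_level_weight[OF I h one] by simp
  have "Poly_Mapping.keys ?y \<noteq> {}"
    using sum by auto
  moreover have "Poly_Mapping.keys ?y \<subseteq> nerve I A"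
  proof
    fix \<sigma> assume "\<sigma> \<in> Poly_Mapping.keys ?y"
    then have "\<sigma> \<subseteq> {i \<in> I. 0 < h i}" "\<sigma> \<noteq> {}"
      using keys by blast+
    then show "\<sigma> \<in> nerve I A"
      using nerve_mono[OF supp] by blast
  qed
  moreover have "\<sigma> \<subset> \<tau> \<or> \<sigma> = \<tau> \<or> \<tau> \<subset> \<sigma>"
    if "\<sigma> \<in> Poly_Mapping.keys ?y" "\<tau> \<in> Poly_Mapping.keys ?y" for \<sigma> \<tau>
  proof (rule ccontr)
    assume "\<not> ?thesis"
    then obtain i j where "i \<in> \<sigma> - \<tau>" "j \<in> \<tau> - \<sigma>" by blast
    then have "h j < h i" "h i < h j"
      using keys[OF that(1)] keys[OF that(2)] by blast+
    then show False by simp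
  qed
  ultimately have "Poly_Mapping.keys ?y \<in> Sd (nerve I A)"
    by (auto simp: Sd_def subset_chain_def)
  then show ?thesis
    using nn sum by (simp add: realization_points_def)
qed

lemma realization_points_SdD:
  assumes "y \<in> realization_points (Sd (nerve I A))"
  shows "Poly_Mapping.keys y \<subseteq> nerve I A"
    and "0 \<le> Poly_Mapping.lookup y \<sigma>"
    and "(\<Sum>\<sigma>\<in>Poly_Mapping.keys y. Poly_Mapping.lookup y \<sigma>) = 1"
    and "Poly_Mapping.keys y \<in> Sd (nerve I A)"
  using assms by (auto simp: realization_points_def Sd_def subset_chain_def)

text \<open>The least element will supply an index common to the whole chain, the greatest one the
  support of \<open>encode\<close>.\<close>

lemma Sd_bounds:
  assumes "C \<in> Sd K"
  obtains \<sigma> \<tau> where "\<sigma> \<in> C" "\<tau> \<in> C" "\<sigma> \<in> K" "\<tau> \<in> K" "\<And>\<rho>. \<rho> \<in> C \<Longrightarrow> \<sigma> \<subseteq> \<rho> \<and> \<rho> \<subseteq> \<tau>"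
proof -
  have C: "subset.chain K C" "finite C" "C \<noteq> {}"
    using assms by (auto simp: Sd_def)
  then have "\<Inter>C \<in> C" "\<Union>C \<in> C"
    using Inter_in_chain Union_in_chain by metis+
  moreover have "C \<subseteq> K"
    using C by (auto simp: subset_chain_def)
  ultimately show thesis
    using that[of "\<Inter>C" "\<Union>C"] by blast
qed

text \<open>Each level weight of \<open>encode I y\<close> is at least the corresponding coordinate
  of \<open>y\<close>. Both families sum to \<open>1\<close>, so all these inequalities are
  equalities.\<close>

lemma decode_encode:
  assumes I: "finite I" and y: "y \<in> realization_points (Sd (nerve I A))"
  shows "decode I (encode I y) = y"
proof -
  note nn = realization_points_SdD(2)[OF y] and sum = realization_points_SdD(3)[OF y]
    and C = realization_points_SdD(4)[OF y]
  have keys: "Poly_Mapping.keys y \<subseteq> Pow I - {{}}"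
    using realization_points_SdD(1)[OF y] by (auto simp: nerve_def)
  have sum': "(\<Sum>\<sigma>\<in>Pow I - {{}}. Poly_Mapping.lookup y \<sigma>) = 1"
    unfolding sum[symmetric]
    by (rule sum.mono_neutral_right) (use I keys in \<open>auto simp: in_keys_iff\<close>)
  have fin: "finite {\<sigma>. \<sigma> \<subseteq> I \<and> P \<sigma>}" for P
    using I by (auto intro: finite_subset[of _ "Pow I"])
  have le1: "encode I y i \<le> 1" for i
    unfolding encode_def sum'[symmetric] by (rule sum_mono2) (use I nn in auto)
  obtain \<sigma>0 where \<sigma>0: "\<sigma>0 \<in> Poly_Mapping.keys y" "\<And>\<rho>. \<rho> \<in> Poly_Mapping.keys y \<Longrightarrow> \<sigma>0 \<subseteq> \<rho>"
    using Sd_bounds[OF C] by metis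
  then obtain i0 where i0: "i0 \<in> \<sigma>0" "i0 \<in> I"
    using keys by blast
  have "encode I y i0 = 1"
    unfolding encode_def sum[symmetric]
    by (rule sum.mono_neutral_right) (use I fin keys \<sigma>0 i0 in \<open>auto simp: in_keys_iff\<close>)
  then have total: "(\<Sum>\<sigma>\<in>Pow I - {{}}. level_weight I (encode I y) \<sigma>) = 1"
    using i0 le1 by (intro sum_level_weight[OF I]) auto
  have ge: "Poly_Mapping.lookup y \<sigma> \<le> level_weight I (encode I y) \<sigma>" if \<sigma>: "\<sigma> \<in> Pow I - {{}}" for \<sigma>
  proof (cases "\<sigma> \<in> Poly_Mapping.keys y")
    case False
    then show ?thesis
      by (simp add: in_keys_iff level_weight_def)
  next
    case True
    show ?thesis
    proof (rule level_weight_ge[OF I])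
      fix i assume i: "i \<in> \<sigma>"
      show "Poly_Mapping.lookup y \<sigma> \<le> encode I y i"
        unfolding encode_def by (rule member_le_sum) (use i \<sigma> fin nn in auto)
      fix j assume j: "j \<in> I - \<sigma>"
      \<comment> \<open>A member of the chain containing \<open>j\<close> is not contained in
        \<open>\<sigma>\<close>, so it properly contains \<open>\<sigma>\<close> and thus
        \<open>i\<close>. The height at \<open>i\<close> also counts \<open>\<sigma>\<close>
        itself.\<close>
      have "encode I y j = (\<Sum>\<tau> | \<tau> \<subseteq> I \<and> j \<in> \<tau> \<and> \<sigma> \<subset> \<tau>. Poly_Mapping.lookup y \<tau>)"
        unfolding encode_def
      proof (rule sum.mono_neutral_right[OF fin])
        have "\<sigma> \<subset> \<tau>" if "\<tau> \<in> Poly_Mapping.keys y" "j \<in> \<tau>" for \<tau>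
          using C True that j by (auto simp: Sd_def subset_chain_def)
        then show "\<forall>\<tau>\<in>{\<tau>. \<tau> \<subseteq> I \<and> j \<in> \<tau>} - {\<tau>. \<tau> \<subseteq> I \<and> j \<in> \<tau> \<and> \<sigma> \<subset> \<tau>}. Poly_Mapping.lookup y \<tau> = 0"
          by (auto simp: in_keys_iff)
      qed auto
      then have "Poly_Mapping.lookup y \<sigma> + encode I y j =
          (\<Sum>\<tau>\<in>insert \<sigma> {\<tau>. \<tau> \<subseteq> I \<and> j \<in> \<tau> \<and> \<sigma> \<subset> \<tau>}. Poly_Mapping.lookup y \<tau>)"
        using fin by simp
      also have "\<dots> \<le> encode I y i"
        unfolding encode_def by (rule sum_mono2) (use i \<sigma> fin nn in auto)
      finally show "Poly_Mapping.lookup y \<sigma> + encode I y j \<le> encode I y i" .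
    qed (use \<sigma> in auto)
  qed
  have "level_weight I (encode I y) \<sigma> = Poly_Mapping.lookup y \<sigma>" if "\<sigma> \<in> Pow I - {{}}" for \<sigma>
    using sum_mono_inv[of "Poly_Mapping.lookup y" "Pow I - {{}}" "level_weight I (encode I y)" \<sigma>]
      total sum' ge that I by simp
  then show ?thesis
    using keys by (intro poly_mapping_eqI) (auto simp: lookup_decode[OF I] in_keys_iff subset_iff)
qed

text \<open>The support is the greatest simplex of the chain, and an index common to the chain
  collects the total weight. \<open>homotopic_decode\<close> asks for such properties.\<close>

lemma encode_realization:
  assumes I: "finite I" and y: "y \<in> realization_points (Sd (nerve I A))"
  shows "encode I y i \<le> 1"
    and "(\<And>\<rho>. \<rho> \<in> Poly_Mapping.keys y \<Longrightarrow> i \<in> \<rho>) \<Longrightarrow> encode I y i = 1"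
    and "{i \<in> I. 0 < encode I y i} \<in> nerve I A"
proof -
  note nn = realization_points_SdD(2)[OF y] and sum = realization_points_SdD(3)[OF y]
    and C = realization_points_SdD(4)[OF y]
  have keys: "Poly_Mapping.keys y \<subseteq> Pow I - {{}}"
    using realization_points_SdD(1)[OF y] by (auto simp: nerve_def)
  have eq: "encode I y i = (\<Sum>\<sigma>\<in>Poly_Mapping.keys y \<inter> {\<sigma>. i \<in> \<sigma>}. Poly_Mapping.lookup y \<sigma>)" for i
    unfolding encode_def
    by (rule sum.mono_neutral_right) (use I keys in \<open>auto simp: in_keys_iff intro: finite_subset[of _ "Pow I"]\<close>)
  show "encode I y i \<le> 1"
    unfolding eq sum[symmetric] by (rule sum_mono2) (use nn in auto)
  show "encode I y i = 1" if "\<And>\<rho>. \<rho> \<in> Poly_Mapping.keys y \<Longrightarrow> i \<in> \<rho>"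
  proof -
    have "Poly_Mapping.keys y \<inter> {\<sigma>. i \<in> \<sigma>} = Poly_Mapping.keys y"
      using that by auto
    then show ?thesis
      using sum eq by simp
  qed
  obtain \<tau> where \<tau>: "\<tau> \<in> Poly_Mapping.keys y" "\<tau> \<in> nerve I A" "\<And>\<rho>. \<rho> \<in> Poly_Mapping.keys y \<Longrightarrow> \<rho> \<subseteq> \<tau>"
    using Sd_bounds[OF C] by metis
  have "0 < encode I y i" if "i \<in> \<tau>" for i
    unfolding eq using that \<tau>(1) nn
    by (intro sum_pos2[of _ \<tau>]) (auto simp: in_keys_iff order.order_iff_strict)
  then have "i \<in> {i \<in> I. 0 < encode I y i}" if "i \<in> \<tau>" for i
    using that \<tau>(1) keys by blast
  moreover have "i \<in> \<tau>" if "0 < encode I y i" for i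
  proof (rule ccontr)
    assume "i \<notin> \<tau>"
    then have "Poly_Mapping.keys y \<inter> {\<sigma>. i \<in> \<sigma>} = {}"
      using \<tau> by blast
    then show False
      using that by (simp add: eq)
  qed
  ultimately have "{i \<in> I. 0 < encode I y i} = \<tau>"
    by blast
  then show "{i \<in> I. 0 < encode I y i} \<in> nerve I A"
    using \<tau> by simp
qed

text \<open>The straight line is drawn between the functions, because a segment between two points
  of the realization may leave it. The line keeps the value \<open>1\<close> at the common index,
  and its support stays within the simplex given by \<open>supp\<close>.\<close>

lemma homotopic_decode:
  fixes p q :: "'a::real_normed_vector \<Rightarrow> 'i \<Rightarrow> real"
  assumes I: "finite I"
    and cont: "\<And>i. i \<in> I \<Longrightarrow> continuous_on T (\<lambda>x. p x i)" "\<And>i. i \<in> I \<Longrightarrow> continuous_on T (\<lambda>x. q x i)"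
    and le1: "\<And>x i. x \<in> T \<Longrightarrow> i \<in> I \<Longrightarrow> p x i \<le> 1 \<and> q x i \<le> 1"
    and one: "\<And>x. x \<in> T \<Longrightarrow> \<exists>i\<in>I. p x i = 1 \<and> q x i = 1"
    and supp: "\<And>x. x \<in> T \<Longrightarrow> {i \<in> I. 0 < p x i \<or> 0 < q x i} \<in> nerve I A"
  shows "homotopic_with_canon (\<lambda>_. True) T (realization_points (Sd (nerve I A)))
           (\<lambda>x. decode I (p x)) (\<lambda>x. decode I (q x))"
proof -
  define r where "r z i = (1 - fst z) * p (snd z) i + fst z * q (snd z) i" for z :: "real \<times> 'a" and i
  have "continuous_on ({0..1} \<times> T) (\<lambda>z. r z i)" if "i \<in> I" for i
  proof -
    have "continuous_on ({0..1} \<times> T) (\<lambda>z. p (snd z) i)" "continuous_on ({0..1} \<times> T) (\<lambda>z. q (snd z) i)"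
      by (rule continuous_on_compose2[OF cont(1)[OF that] continuous_on_snd[OF continuous_on_id]],
          force)
        (rule continuous_on_compose2[OF cont(2)[OF that] continuous_on_snd[OF continuous_on_id]],
          force)
    then show ?thesis
      unfolding r_def by (intro continuous_intros)
  qed
  then have "continuous_on ({0..1} \<times> T) (\<lambda>z. decode I (r z))"
    by (intro continuous_on_decode[OF I])
  moreover have "decode I (r z) \<in> realization_points (Sd (nerve I A))" if z: "z \<in> {0..1} \<times> T" for z
  proof (rule decode_mem_realization[OF I])
    obtain t x where tx: "z = (t, x)" "0 \<le> t" "t \<le> 1" "x \<in> T"
      using z by auto
    show "r z i \<le> 1" if "i \<in> I" for i
      using le1[OF tx(4) that] tx by (auto simp: r_def intro!: convex_bound_le)
    show "\<exists>i\<in>I. r z i = 1"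
    proof -
      obtain i where "i \<in> I" "p x i = 1" "q x i = 1"
        using one[OF tx(4)] by blast
      then have "r z i = 1"
        by (simp add: r_def tx(1))
      with \<open>i \<in> I\<close> show ?thesis by blast
    qed
    then have "{i \<in> I. 0 < r z i} \<noteq> {}"
      by force
    moreover have "p x i > 0 \<or> q x i > 0" if "r z i > 0" for i
    proof (rule ccontr)
      assume "\<not> ?thesis"
      then have "r z i \<le> 0"
        unfolding r_def using tx by (auto intro!: convex_bound_le)
      then show False using that by simp
    qed
    ultimately show "{i \<in> I. 0 < r z i} \<in> nerve I A"
      by (intro nerve_mono[OF supp[OF tx(4)]]) auto
  qed
  moreover have "r (0, x) = p x" "r (1, x) = q x" for x
    by (auto simp: r_def)
  ultimately show ?thesis
    unfolding homotopic_with_def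
    by (intro exI[of _ "\<lambda>z. decode I (r z)"]) (auto simp: image_subset_iff)
qed

section \<open>A nerve theorem for closed convex covers\<close>

text \<open>The sets \<open>A i\<close> are swollen to \<open>d i x < \<delta> x\<close>. If the
  swollen sets over a non-simplex \<open>J\<close> met at \<open>x\<close>, then
  \<open>m J x < \<delta> x\<close>, contrary to the choice of \<open>\<delta>\<close>. The radius
  varies with \<open>x\<close> because disjoint closed sets may have distance zero.\<close>

lemma swelling_weights:
  fixes A :: "'i \<Rightarrow> 'a::metric_space set"
  assumes I: "finite I" and A: "\<And>i. i \<in> I \<Longrightarrow> closed (A i)"
  obtains w :: "'a \<Rightarrow> 'i \<Rightarrow> real" where
    "\<And>i. i \<in> I \<Longrightarrow> continuous_on UNIV (\<lambda>x. w x i)"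
    "\<And>x i. w x i \<le> 1"
    "\<And>x i. i \<in> I \<Longrightarrow> x \<in> A i \<Longrightarrow> w x i = 1"
    "\<And>x. x \<in> (\<Union>i\<in>I. A i) \<Longrightarrow> {i \<in> I. 0 < w x i} \<in> nerve I A"
proof -
  define N where "N = Pow I - {{}} - nerve I A"
  \<comment> \<open>The case distinction is needed because \<open>infdist x {} = 0\<close>.\<close>
  define d where "d i x = (if A i = {} then 1 else infdist x (A i))" for i x
  define m where "m J x = Max ((\<lambda>i. d i x) ` J)" for J x
  \<comment> \<open>The inserted \<open>1\<close> keeps \<open>\<delta>\<close> defined and positive
    when every non-empty set of indices is a simplex.\<close>
  define \<delta> where "\<delta> x = Min (insert 1 ((\<lambda>J. m J x) ` N))" for x
  define w where "w x i = max 0 (1 - d i x / \<delta> x)" for x i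
  have N: "finite N" "\<And>J. J \<in> N \<Longrightarrow> finite J \<and> J \<noteq> {}"
    using I finite_subset by (auto simp: N_def)
  have d0: "0 \<le> d i x" for i x
    by (simp add: d_def infdist_nonneg)
  have d_eq: "d i x = 0 \<longleftrightarrow> x \<in> A i" if "i \<in> I" for i x
    using in_closed_iff_infdist_zero[OF A[OF that]] by (auto simp: d_def)
  have cont_d: "continuous_on UNIV (d i)" for i
    by (cases "A i = {}") (auto simp: d_def[abs_def] intro!: continuous_intros)
  have m_pos: "0 < m J x" if J: "J \<in> N" for J x
  proof -
    have "finite J" "J \<noteq> {}" "J \<subseteq> I" "J \<notin> nerve I A"
      using J N by (auto simp: N_def)
    then obtain i where "i \<in> J" "x \<notin> A i"
      unfolding nerve_def by auto
    then have "0 < d i x"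
      using d_eq d0 \<open>J \<subseteq> I\<close> by (metis order_le_less subsetD)
    then show ?thesis
      unfolding m_def using \<open>finite J\<close> \<open>i \<in> J\<close> by (subst Max_gr_iff) auto
  qed
  have \<delta>_pos: "0 < \<delta> x" for x
    unfolding \<delta>_def using N m_pos by (subst Min_gr_iff) auto
  have \<delta>_le: "\<delta> x \<le> m J x" if "J \<in> N" for J x
    unfolding \<delta>_def using N that by (intro Min_le) auto
  have cont_\<delta>: "continuous_on UNIV \<delta>"
  proof (cases "N = {}")
    case True
    then show ?thesis
      by (simp add: \<delta>_def[abs_def])
  next
    case False
    have "continuous_on UNIV (m J)" if "J \<in> N" for J
      unfolding m_def[abs_def] using N that cont_d by (intro continuous_on_Max_image) auto
    then have "continuous_on UNIV (\<lambda>x. min 1 (Min ((\<lambda>J. m J x) ` N)))"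
      using N False by (intro continuous_on_const continuous_on_min continuous_on_Min_image) auto
    moreover have "\<delta> x = min 1 (Min ((\<lambda>J. m J x) ` N))" for x
      unfolding \<delta>_def using N False by (intro Min_insert) auto
    ultimately show ?thesis
      by presburger
  qed
  show thesis
  proof
    show "continuous_on UNIV (\<lambda>x. w x i)" for i
      unfolding w_def using \<delta>_pos less_imp_neq[OF \<delta>_pos]
      by (intro continuous_on_max continuous_intros cont_d cont_\<delta>) (metis less_irrefl)
    show "w x i \<le> 1" for x i
      using d0 \<delta>_pos by (simp add: w_def order_less_imp_le)
    show *: "w x i = 1" if "i \<in> I" "x \<in> A i" for x i
      using d_eq[of i x] that by (simp add: w_def)
    show "{i \<in> I. 0 < w x i} \<in> nerve I A" (is "?J \<in> _") if x: "x \<in> (\<Union>i\<in>I. A i)" for x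
    proof (rule ccontr)
      assume "?J \<notin> nerve I A"
      moreover have "?J \<noteq> {}"
        using x * by force
      ultimately have J: "?J \<in> N"
        by (auto simp: N_def)
      have "d i x < \<delta> x" if "i \<in> ?J" for i
        using that \<delta>_pos[of x] by (auto simp: w_def less_max_iff_disj)
      then have "m ?J x < \<delta> x"
        unfolding m_def using N(2)[OF J] by (subst Max_less_iff) auto
      then show False
        using \<delta>_le[OF J, of x] by simp
    qed
  qed
qed

section \<open>The affine extension of a choice of base points\<close>

definition barycentric_map :: "('v \<Rightarrow> 'a::real_vector) \<Rightarrow> ('v \<Rightarrow>\<^sub>0 real) \<Rightarrow> 'a"
  where "barycentric_map u y = (\<Sum>v\<in>Poly_Mapping.keys y. Poly_Mapping.lookup y v *\<^sub>R u v)"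

lemma barycentric_map_superset:
  assumes "finite F" "Poly_Mapping.keys y \<subseteq> F"
  shows "barycentric_map u y = (\<Sum>v\<in>F. Poly_Mapping.lookup y v *\<^sub>R u v)"
  unfolding barycentric_map_def
  by (rule sum.mono_neutral_left) (use assms in \<open>auto simp: in_keys_iff\<close>)

text \<open>Vertices identified by \<open>\<psi>\<close> have their coordinates added, so the sum is
  regrouped along the fibres of \<open>\<psi>\<close>.\<close>

lemma barycentric_map_realization_map:
  "barycentric_map u (realization_map \<psi> y) =
    (\<Sum>v\<in>Poly_Mapping.keys y. Poly_Mapping.lookup y v *\<^sub>R u (\<psi> v))"
proof -
  let ?K = "Poly_Mapping.keys y"
  have lookup: "Poly_Mapping.lookup (realization_map \<psi> y) w =
      (\<Sum>v | v \<in> ?K \<and> \<psi> v = w. Poly_Mapping.lookup y v)" for w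
    unfolding realization_map_def lookup_sum
    by (rule sum.mono_neutral_cong_right) (auto simp: lookup_single when_def)
  \<comment> \<open>Only an inclusion: for arbitrary \<open>y\<close>, coordinates may cancel within
    a fibre.\<close>
  have "Poly_Mapping.keys (realization_map \<psi> y) \<subseteq> \<psi> ` ?K"
  proof
    fix w assume "w \<in> Poly_Mapping.keys (realization_map \<psi> y)"
    then have "{v. v \<in> ?K \<and> \<psi> v = w} \<noteq> {}"
      unfolding in_keys_iff lookup by (metis (no_types, lifting) sum.empty)
    then show "w \<in> \<psi> ` ?K"
      by blast
  qed
  then have "barycentric_map u (realization_map \<psi> y) =
      (\<Sum>w\<in>\<psi> ` ?K. Poly_Mapping.lookup (realization_map \<psi> y) w *\<^sub>R u w)"
    by (intro barycentric_map_superset) auto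
  also have "\<dots> = (\<Sum>w\<in>\<psi> ` ?K. \<Sum>v | v \<in> ?K \<and> \<psi> v = w. Poly_Mapping.lookup y v *\<^sub>R u (\<psi> v))"
    unfolding lookup scaleR_sum_left by (intro sum.cong) auto
  also have "\<dots> = (\<Sum>v\<in>?K. Poly_Mapping.lookup y v *\<^sub>R u (\<psi> v))"
    by (rule sum.image_gen[symmetric]) simp
  finally show ?thesis .
qed

lemma barycentric_map_mem:
  assumes y: "y \<in> realization_points (Sd (nerve I A))"
    and u: "\<And>\<sigma>. \<sigma> \<in> nerve I A \<Longrightarrow> u \<sigma> \<in> (\<Inter>i\<in>\<sigma>. A i)"
    and "convex (A i)" and i: "\<And>\<rho>. \<rho> \<in> Poly_Mapping.keys y \<Longrightarrow> i \<in> \<rho>"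
  shows "barycentric_map u y \<in> A i"
  unfolding barycentric_map_def
proof (rule convex_sum[OF _ \<open>convex (A i)\<close>])
  show "u \<sigma> \<in> A i" if "\<sigma> \<in> Poly_Mapping.keys y" for \<sigma>
    using u i that realization_points_SdD(1)[OF y] by blast
qed (use realization_points_SdD[OF y] in auto)

text \<open>Any index in the least simplex will do. It places all base points of the chain in one
  member of the cover, where convexity and affinity apply.\<close>

lemma realization_Sd_nerve_apex:
  assumes y: "y \<in> realization_points (Sd (nerve I A))"
  obtains i where "i \<in> I" "\<And>\<rho>. \<rho> \<in> Poly_Mapping.keys y \<Longrightarrow> i \<in> \<rho>"
proof -
  obtain \<sigma> where \<sigma>: "\<sigma> \<in> nerve I A" "\<And>\<rho>. \<rho> \<in> Poly_Mapping.keys y \<Longrightarrow> \<sigma> \<subseteq> \<rho>"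
    using Sd_bounds[OF realization_points_SdD(4)[OF y]] by metis
  then obtain i where "i \<in> \<sigma>" "i \<in> I"
    unfolding nerve_def by blast
  with \<sigma> that show thesis by blast
qed

lemma homotopy_equivalence_barycentric_map:
  fixes A :: "'i \<Rightarrow> 'a::real_normed_vector set"
  assumes I: "finite I" and closed: "\<And>i. i \<in> I \<Longrightarrow> closed (A i)"
    and convex: "\<And>i. i \<in> I \<Longrightarrow> convex (A i)"
    and u: "\<And>\<sigma>. \<sigma> \<in> nerve I A \<Longrightarrow> u \<sigma> \<in> (\<Inter>i\<in>\<sigma>. A i)"
  shows "homotopy_equivalence (realization (Sd (nerve I A))) (top_of_set (\<Union>i\<in>I. A i))
           (barycentric_map u)"
proof -
  define R where "R = realization_points (Sd (nerve I A))"
  define X where "X = (\<Union>i\<in>I. A i)"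
  define \<Gamma> where "\<Gamma> = barycentric_map u"
  obtain w :: "'a \<Rightarrow> 'i \<Rightarrow> real" where
    w_cont: "\<And>i. i \<in> I \<Longrightarrow> continuous_on UNIV (\<lambda>x. w x i)"
    and w_le: "\<And>x i. w x i \<le> 1"
    and w_eq: "\<And>x i. i \<in> I \<Longrightarrow> x \<in> A i \<Longrightarrow> w x i = 1"
    and w_supp: "\<And>x. x \<in> (\<Union>i\<in>I. A i) \<Longrightarrow> {i \<in> I. 0 < w x i} \<in> nerve I A"
    by (rule swelling_weights[OF I, of A]) (use closed in blast)+
  note w_supp = w_supp[folded X_def]
  define g where "g x = decode I (w x)" for x

  have \<Gamma>_A: "\<Gamma> y \<in> A i" if "y \<in> R" "i \<in> I" "\<And>\<rho>. \<rho> \<in> Poly_Mapping.keys y \<Longrightarrow> i \<in> \<rho>" for y i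
    unfolding \<Gamma>_def using that u convex by (intro barycentric_map_mem) (auto simp: R_def)
  \<comment> \<open>A single index must serve both purposes: it makes \<open>encode I y\<close> and
    \<open>w (\<Gamma> y)\<close> equal to \<open>1\<close> at the same vertex.\<close>
  have apex: "\<exists>i\<in>I. \<Gamma> y \<in> A i \<and> encode I y i = 1" if y: "y \<in> R" for y
  proof -
    obtain i where "i \<in> I" "\<And>\<rho>. \<rho> \<in> Poly_Mapping.keys y \<Longrightarrow> i \<in> \<rho>"
      using y realization_Sd_nerve_apex unfolding R_def by metis
    then show ?thesis
      using \<Gamma>_A encode_realization(2)[OF I] y unfolding R_def by blast
  qed
  then have \<Gamma>_X: "\<Gamma> ` R \<subseteq> X"
    by (auto simp: X_def)
  have \<Gamma>_cont: "continuous_on R \<Gamma>"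
  proof (rule continuous_on_eq)
    \<comment> \<open>The keys vary with \<open>y\<close>; the sum over the whole finite nerve does
      not.\<close>
    show "continuous_on R (\<lambda>y. \<Sum>\<sigma>\<in>nerve I A. Poly_Mapping.lookup y \<sigma> *\<^sub>R u \<sigma>)"
      by (intro continuous_intros continuous_on_lookup)
    show "(\<Sum>\<sigma>\<in>nerve I A. Poly_Mapping.lookup y \<sigma> *\<^sub>R u \<sigma>) = \<Gamma> y" if "y \<in> R" for y
      using that barycentric_map_superset[OF finite_nerve[OF I] realization_points_SdD(1)]
      unfolding R_def \<Gamma>_def by metis
  qed
  have g_cont: "continuous_on X g"
    unfolding g_def using w_cont continuous_on_subset by (intro continuous_on_decode[OF I]) blast
  have g_R: "g ` X \<subseteq> R"
  proof (rule image_subsetI)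
    fix x assume x: "x \<in> X"
    then have "\<exists>i\<in>I. w x i = 1"
      using w_eq unfolding X_def by blast
    then show "g x \<in> R"
      unfolding g_def R_def using x w_le w_supp by (intro decode_mem_realization[OF I]) auto
  qed

  have "homotopic_with_canon (\<lambda>_. True) X X (\<Gamma> \<circ> g) id"
  proof (rule homotopic_with_linear)
    show "continuous_on X (\<Gamma> \<circ> g)"
      using g_cont g_R \<Gamma>_cont by (metis continuous_on_compose continuous_on_subset)
    show "closed_segment ((\<Gamma> \<circ> g) x) (id x) \<subseteq> X" if x: "x \<in> X" for x
    proof -
      obtain i where i: "i \<in> I" "x \<in> A i"
        using x by (auto simp: X_def)
      \<comment> \<open>If \<open>\<rho>\<close> missed \<open>i\<close>, its elements
        \<open>k\<close> would satisfy \<open>w x i < w x k\<close>, although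
        \<open>w x i = 1\<close> is maximal.\<close>
      have "i \<in> \<rho>" if "\<rho> \<in> Poly_Mapping.keys (g x)" for \<rho>
        using keys_decodeD[OF I that[unfolded g_def]] w_eq[OF i] w_le[of x] i
        by (metis Diff_iff all_not_in_conv linorder_not_less)
      then have "\<Gamma> (g x) \<in> A i"
        using g_R x i by (intro \<Gamma>_A) auto
      then have "closed_segment (\<Gamma> (g x)) x \<subseteq> A i"
        using i convex by (intro closed_segment_subset) auto
      then show ?thesis
        using i by (auto simp: X_def)
    qed
  qed simp
  moreover
  have "homotopic_with_canon (\<lambda>_. True) R R (g \<circ> \<Gamma>) id"
  proof -
    have wc: "continuous_on R (\<lambda>y. w (\<Gamma> y) i)" if "i \<in> I" for i
      using continuous_on_compose2[OF w_cont[OF that] \<Gamma>_cont] by simp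
    have ec: "continuous_on R (\<lambda>y. encode I y i)" for i
      unfolding encode_def by (intro continuous_intros continuous_on_lookup)
    let ?m = "\<lambda>y i. min (encode I y i) (w (\<Gamma> y) i)"
    have mc: "continuous_on R (\<lambda>y. ?m y i)" if "i \<in> I" for i
      using that by (intro continuous_on_min wc ec)
    have le: "encode I y i \<le> 1" if "y \<in> R" for y i
      using encode_realization(1)[OF I] that by (simp add: R_def)
    have one: "\<exists>i\<in>I. w (\<Gamma> y) i = 1 \<and> encode I y i = 1" if "y \<in> R" for y
      using apex[OF that] w_eq by blast
    \<comment> \<open>The supports of \<open>encode I y\<close> and \<open>w (\<Gamma> y)\<close> need not span a common simplex, so the
      homotopy passes through their minimum.\<close>
    have "homotopic_with_canon (\<lambda>_. True) R R (\<lambda>y. decode I (w (\<Gamma> y))) (\<lambda>y. decode I (?m y))"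
      unfolding R_def
    proof (rule homotopic_decode[OF I], fold R_def)
      show "{i \<in> I. 0 < w (\<Gamma> y) i \<or> 0 < ?m y i} \<in> nerve I A" if "y \<in> R" for y
      proof -
        \<comment> \<open>The minimum is positive only where both functions are, so the union of
          supports is a single support, already known to be a simplex.\<close>
        have "{i \<in> I. 0 < w (\<Gamma> y) i \<or> 0 < ?m y i} = {i \<in> I. 0 < w (\<Gamma> y) i}"
          by auto
        then show ?thesis
          using w_supp \<Gamma>_X that by auto
      qed
      show "\<exists>i\<in>I. w (\<Gamma> y) i = 1 \<and> ?m y i = 1" if "y \<in> R" for y
        using one[OF that] by force
    qed (use wc mc w_le le in \<open>auto simp: min_le_iff_disj\<close>)
    moreover have "homotopic_with_canon (\<lambda>_. True) R R (\<lambda>y. decode I (?m y)) (\<lambda>y. decode I (encode I y))"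
      unfolding R_def
    proof (rule homotopic_decode[OF I], fold R_def)
      show "{i \<in> I. 0 < ?m y i \<or> 0 < encode I y i} \<in> nerve I A" if "y \<in> R" for y
      proof -
        have "{i \<in> I. 0 < ?m y i \<or> 0 < encode I y i} = {i \<in> I. 0 < encode I y i}"
          by auto
        then show ?thesis
          using encode_realization(3)[OF I] that by (simp add: R_def)
      qed
      show "\<exists>i\<in>I. ?m y i = 1 \<and> encode I y i = 1" if "y \<in> R" for y
        using one[OF that] by force
    qed (use ec mc w_le le in \<open>auto simp: min_le_iff_disj\<close>)
    ultimately have "homotopic_with_canon (\<lambda>_. True) R R (\<lambda>y. decode I (w (\<Gamma> y))) (\<lambda>y. decode I (encode I y))"
      by (rule homotopic_with_trans)
    then show ?thesis
      by (rule homotopic_with_eq) (auto simp: g_def decode_encode[OF I] R_def)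
  qed
  ultimately show ?thesis
    unfolding homotopy_equivalence_def realization_Sd_nerve[OF I] R_def[symmetric] X_def[symmetric]
      \<Gamma>_def[symmetric]
    using \<Gamma>_cont \<Gamma>_X g_cont g_R by (auto simp: image_subset_iff_funcset)
qed

section \<open>Objects and morphisms of the category\<close>

text \<open>\<open>Rn d\<close> is cut out by vanishing coordinates and is therefore closed in the
  whole type, so relative closedness becomes absolute.\<close>

lemma ClConv_obj_closed:
  assumes "ClConv_obj P" "i \<in> index P"
  shows "closed (members P i)"
proof -
  have "closed (Rn d)" for d
    unfolding Rn_def by (rule closed_Collect_keys_subset)
  then show ?thesis
    using assms closedin_closed_trans unfolding ClConv_obj_def by blast
qed

text \<open>\<open>f\<close> is affine only on single members of the cover, but one member contains
  all base points of the chain of \<open>x\<close>. Hence \<open>f\<close> commutes with their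
  convex combination, and it sends base points to base points.\<close>

lemma barycentric_map_natural:
  assumes P: "ClConv_obj P" and f: "ClConv_mor P Q f \<phi>"
    and x: "x \<in> realization_points (Sd (Nrv P))"
  shows "f (barycentric_map (basepoint P) x) =
    barycentric_map (basepoint Q) (realization_map (Sd_map \<phi>) x)"
proof -
  let ?K = "Poly_Mapping.keys x"
  note K = realization_points_SdD(1)[OF x]
  obtain i where i: "i \<in> index P" "\<And>\<rho>. \<rho> \<in> ?K \<Longrightarrow> i \<in> \<rho>"
    using realization_Sd_nerve_apex[OF x] by metis
  have "f (barycentric_map (basepoint P) x) =
      (\<Sum>\<sigma>\<in>?K. Poly_Mapping.lookup x \<sigma> *\<^sub>R f (basepoint P \<sigma>))"
    unfolding barycentric_map_def
  proof (rule affine_linear_on_sum)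
    show "affine_linear_on (members P i) f" "convex (members P i)"
      using P f i by (auto simp: ClConv_obj_def ClConv_mor_def)
    show "basepoint P \<sigma> \<in> members P i" if "\<sigma> \<in> ?K" for \<sigma>
      using P K i that unfolding ClConv_obj_def pointed_cover_def by blast
  qed (use realization_points_SdD[OF x] in auto)
  also have "\<dots> = (\<Sum>\<sigma>\<in>?K. Poly_Mapping.lookup x \<sigma> *\<^sub>R basepoint Q (Sd_map \<phi> \<sigma>))"
    using f K by (intro sum.cong) (auto simp: ClConv_mor_def pointed_covered_mor_def Sd_map_def)
  finally show ?thesis
    by (simp add: barycentric_map_realization_map)
qed

theorem theorem2:
  shows "\<exists>\<Gamma> :: 'i pointed_covered_space \<Rightarrow> ('i set \<Rightarrow>\<^sub>0 real) \<Rightarrow> (nat \<Rightarrow>\<^sub>0 real).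
    (\<forall>P. ClConv_obj P \<longrightarrow>
       homotopy_equivalence (realization (Sd (Nrv P))) (top_of_set (underlying P)) (\<Gamma> P)) \<and>
    (\<forall>P Q f \<phi>. ClConv_obj P \<and> ClConv_obj Q \<and> ClConv_mor P Q f \<phi> \<longrightarrow>
       (\<forall>x \<in> topspace (realization (Sd (Nrv P))).
          f (\<Gamma> P x) = \<Gamma> Q (realization_map (Sd_map \<phi>) x)))"
\<comment> \<open>The witness involves base points only. The weights \<open>w\<close>, whose choice
  is not natural, enter just the homotopy inverse.\<close>
proof (rule exI[of _ "\<lambda>P. barycentric_map (basepoint P)"], intro conjI allI impI ballI)
  fix P :: "'i pointed_covered_space"
  assume P: "ClConv_obj P"
  then have "underlying P = (\<Union>i\<in>index P. members P i)"
    by (simp add: ClConv_obj_def pointed_cover_def)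
  moreover have "homotopy_equivalence (realization (Sd (Nrv P)))
      (top_of_set (\<Union>i\<in>index P. members P i)) (barycentric_map (basepoint P))"
  proof (rule homotopy_equivalence_barycentric_map)
    show "closed (members P i)" if "i \<in> index P" for i
      using P that by (rule ClConv_obj_closed)
  qed (use P in \<open>auto simp: ClConv_obj_def pointed_cover_def\<close>)
  ultimately show "homotopy_equivalence (realization (Sd (Nrv P))) (top_of_set (underlying P))
      (barycentric_map (basepoint P))"
    by simp
qed (auto intro: barycentric_map_natural)

end
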